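(* Let $n=1$ and let $W\colon\mathbb{R}\to\mathbb{R}$ be a radially symmetric (i.e. even) function of class $C^2$, written $W(x)=w(|x|)$, such that: (i) $W(0)=0$ and there is $R>0$ such that $W(x)<0$ if $0<|x|<R$ and $W(x)\ge0$ if $|x|\ge R$; (ii) there exist $\alpha>2$ and $C>0$ such that $w'(s)\,s^{1-\alpha}\to-C$ as $s\to0^+$; (iii) there exists $r\in(0,R]$ such that $\sqrt{-w}$ is strictly convex on $(0,r)$. Let $\mu\in\mathcal{P}(\mathbb{R})$ be a global minimizer of the interaction energy associated with $W$. Then, with $R$ as in (i) and $r$ as in (iii), $\operatorname{card}(\operatorname{supp}\mu)\le 2\lceil R/r\rceil+1$.
   Context: $\mathcal{P}(\mathbb{R})$ is the set of Borel probability measures on $\mathbb{R}$. The interaction energy is $E(\mu)=\frac12\int_{\mathbb{R}}\int_{\mathbb{R}}W(x-y)\,d\mu(x)\,d\mu(y)\in\mathbb{R}\cup\{+\infty\}$ for $\mu\in\mathcal{P}(\mathbb{R})$. A global minimizer is $\mu\in\mathcal{P}(\mathbb{R})$ with $E(\mu)\le E(\nu)$ for all $\nu\in\mathcal{P}(\mathbb{R})$. $\lceil\cdot\rceil$ denotes the ceiling function. *)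

theory Defs
  imports "HOL-Probability.Probability"
begin

definition borel_probs :: "real measure set" where
  "borel_probs = {\<mu>. prob_space \<mu> \<and> sets \<mu> = sets borel}"

text \<open>
  The library's Bochner integral is real-valued and returns 0 on non-integrable functions, so
  the integral with values in the extended reals is defined here as the integral of the
  positive part minus the integral of the negative part (\<^const>\<open>e2ennreal\<close> truncates negative
  values to 0). The difference is meaningful unless both parts are infinite; this does not occur
  in the energy below for \<open>W\<close> bounded below.
\<close>
definition ext_integral :: "'a measure \<Rightarrow> ('a \<Rightarrow> ereal) \<Rightarrow> ereal" where
  "ext_integral M f =
     enn2ereal (\<integral>\<^sup>+ x. e2ennreal (f x) \<partial>M) - enn2ereal (\<integral>\<^sup>+ x. e2ennreal (- f x) \<partial>M)"

definition interaction_energy :: "(real \<Rightarrow> real) \<Rightarrow> real measure \<Rightarrow> ereal" where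
  "interaction_energy W \<mu> =
     ereal (1/2) * ext_integral \<mu> (\<lambda>y. ext_integral \<mu> (\<lambda>x. ereal (W (x - y))))"

definition global_minimizer :: "(real \<Rightarrow> real) \<Rightarrow> real measure \<Rightarrow> bool" where
  "global_minimizer W \<mu> \<longleftrightarrow>
     \<mu> \<in> borel_probs \<and> (\<forall>\<nu>\<in>borel_probs. interaction_energy W \<mu> \<le> interaction_energy W \<nu>)"

definition measure_support :: "'a::topological_space measure \<Rightarrow> 'a set" where
  "measure_support \<mu> = {x. \<forall>U. open U \<longrightarrow> x \<in> U \<longrightarrow> emeasure \<mu> U > 0}"

definition class_C2 :: "(real \<Rightarrow> real) \<Rightarrow> bool" where
  "class_C2 f \<longleftrightarrow> (\<exists>f' f''. (\<forall>x. (f has_real_derivative f' x) (at x)) \<and>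
     (\<forall>x. (f' has_real_derivative f'' x) (at x)) \<and> continuous_on UNIV f'')"

definition strictly_convex_on :: "'a::real_vector set \<Rightarrow> ('a \<Rightarrow> real) \<Rightarrow> bool" where
  "strictly_convex_on S f \<longleftrightarrow> convex S \<and>
     (\<forall>x\<in>S. \<forall>y\<in>S. \<forall>t. x \<noteq> y \<longrightarrow> 0 < t \<longrightarrow> t < 1 \<longrightarrow>
        f ((1 - t) *\<^sub>R x + t *\<^sub>R y) < (1 - t) * f x + t * f y)"

end

theory Submission
  imports Defs
begin

text \<open>
  Perturb a minimizer \<open>\<mu>\<close> to \<open>(1 + \<epsilon> h) \<mu>\<close>, where \<open>h\<close> is bounded and \<open>\<integral>h d\<mu> = 0\<close>. For small
  \<open>\<bar>\<epsilon>\<bar>\<close> these are probability measures for both signs of \<open>\<epsilon>\<close>, so the first variation vanishes and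
  the second one, \<open>\<integral>\<integral>W(x - y) h(x) h(y) d\<mu> d\<mu>\<close>, is nonnegative. Letting \<open>h\<close> concentrate at finitely many
  points of the support gives \<open>\<Sum> c\<^sub>i c\<^sub>j W(x\<^sub>i - x\<^sub>j) \<ge> 0\<close> whenever \<open>\<Sum> c\<^sub>i = 0\<close>
  (\<open>conditionally_positive_on_support\<close>). Two and three points suffice for what follows: on the
  support, \<open>W(x - y) \<le> 0\<close> and \<open>\<surd>(-W(x - y))\<close> is a pseudometric.

  A strictly convex function on \<open>(0, r)\<close> with limit \<open>0\<close> at \<open>0\<close> is strictly superadditive there, which for
  \<open>\<surd>(-w)\<close> contradicts the triangle inequality. Hence three points \<open>x < y < z\<close> of the support satisfy
  \<open>z - x \<ge> r\<close>. Cutting an interval of length less than \<open>R\<close> into \<open>\<lceil>R/r\<rceil>\<close> half-open pieces of length \<open>r\<close>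
  shows that it contains at most \<open>2\<lceil>R/r\<rceil>\<close> points of the support.

  The support itself may be longer than \<open>R\<close>, because \<open>W\<close> may vanish outside \<open>(-R, R)\<close>. Suppose that
  it contains \<open>a\<close> and \<open>b\<close> with \<open>b - a \<ge> R\<close>. Then \<open>W(b - a) = 0\<close>, so \<open>a\<close> and \<open>b\<close> have pseudodistance \<open>0\<close>
  and \<open>W(z - a) = W(z - b)\<close> for each \<open>z\<close> in the support. The pseudometric is not identically \<open>0\<close>, since
  otherwise the energy would be nonnegative, while two equal masses at distance \<open>R/2\<close> have negative
  energy. This forces every other point of the support into \<open>(b - R, a + R)\<close>, an interval of length at
  most \<open>R\<close>, so removing the single point \<open>b\<close> leaves a set in which any two points are closer than \<open>R\<close>
  (\<open>diam_after_removal\<close>). The removed point is the \<open>1\<close> in the bound \<open>2\<lceil>R/r\<rceil> + 1\<close>.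
\<close>

section \<open>The energy as an integral of a nonnegative kernel\<close>

text \<open>
  Adding a constant to a kernel that is bounded below makes it nonnegative and, on probability measures,
  shifts the double integral by that constant. The double integral can then be taken in \<^typ>\<open>ennreal\<close>,
  where Tonelli's theorem applies without integrability assumptions.
\<close>
definition nn_energy :: "(real \<Rightarrow> real) \<Rightarrow> real measure \<Rightarrow> ennreal" where
  "nn_energy g \<mu> = (\<integral>\<^sup>+ y. \<integral>\<^sup>+ x. ennreal (g (x - y)) \<partial>\<mu> \<partial>\<mu>)"

text \<open>
  Integrate the pointwise identity \<open>f\<^sup>+ + c = (f + c) + f\<^sup>-\<close>; since \<open>f\<^sup>- \<le> c\<close>, the integral of \<open>f\<^sup>-\<close> is
  finite and can be subtracted.
\<close>
lemma ext_integral_shift: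
  fixes f :: "'a \<Rightarrow> ereal" and c :: real
  assumes "prob_space N" and f[measurable]: "f \<in> borel_measurable N"
    and c: "c \<ge> 0" and lb: "\<And>x. - ereal c \<le> f x"
  shows "ext_integral N f = enn2ereal (\<integral>\<^sup>+ x. e2ennreal (f x + ereal c) \<partial>N) - ereal c"
proof -
  interpret prob_space N by fact
  have pw: "e2ennreal (f x) + ennreal c = e2ennreal (f x + ereal c) + e2ennreal (- f x)" for x
  proof (cases "f x")
    case (real u)
    have "- c \<le> u" using lb[of x] real by simp
    then show ?thesis using c real
      by (cases "u \<ge> 0") (auto simp: ennreal.abs_eq[symmetric] ennreal_neg simp flip: ennreal_plus)
  next
    case PInf then show ?thesis by (simp add: e2ennreal_infty)
  next
    case MInf then show ?thesis using lb[of x] by simp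
  qed
  have "(\<integral>\<^sup>+ x. e2ennreal (f x) \<partial>N) + ennreal c = (\<integral>\<^sup>+ x. e2ennreal (f x) + ennreal c \<partial>N)"
    by (subst nn_integral_add) (auto simp: emeasure_space_1)
  also have "\<dots> = (\<integral>\<^sup>+ x. e2ennreal (f x + ereal c) \<partial>N) + (\<integral>\<^sup>+ x. e2ennreal (- f x) \<partial>N)"
    unfolding pw by (rule nn_integral_add) auto
  finally have eq: "(\<integral>\<^sup>+ x. e2ennreal (f x) \<partial>N) + ennreal c
    = (\<integral>\<^sup>+ x. e2ennreal (f x + ereal c) \<partial>N) + (\<integral>\<^sup>+ x. e2ennreal (- f x) \<partial>N)" .
  have "e2ennreal (- f x) \<le> ennreal c" for x
  proof -
    have "- f x \<le> ereal c" using lb[of x] by (metis ereal_minus_le_minus ereal_uminus_uminus)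
    then have "e2ennreal (- f x) \<le> e2ennreal (ereal c)" by (rule e2ennreal_mono)
    then show ?thesis by simp
  qed
  then have "(\<integral>\<^sup>+ x. e2ennreal (- f x) \<partial>N) \<le> (\<integral>\<^sup>+ x. ennreal c \<partial>N)"
    by (intro nn_integral_mono) auto
  also have "\<dots> = ennreal c" by (simp add: emeasure_space_1)
  finally have "(\<integral>\<^sup>+ x. e2ennreal (- f x) \<partial>N) < \<infinity>"
    using le_less_trans by fastforce
  then obtain n where n: "(\<integral>\<^sup>+ x. e2ennreal (- f x) \<partial>N) = ennreal n" "n \<ge> 0"
    by (cases "\<integral>\<^sup>+ x. e2ennreal (- f x) \<partial>N") auto
  show ?thesis
  proof (cases "\<integral>\<^sup>+ x. e2ennreal (f x) \<partial>N")
    case (real p)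
    then obtain q where q: "(\<integral>\<^sup>+ x. e2ennreal (f x + ereal c) \<partial>N) = ennreal q" "q \<ge> 0"
      using eq c n by (cases "\<integral>\<^sup>+ x. e2ennreal (f x + ereal c) \<partial>N") (auto simp flip: ennreal_plus)
    have "p + c = q + n"
      using eq c n q real by (simp flip: ennreal_plus)
    then show ?thesis
      unfolding ext_integral_def using n q real by (simp add: enn2ereal_ennreal)
  next
    case top
    then have "(\<integral>\<^sup>+ x. e2ennreal (f x + ereal c) \<partial>N) = top"
      using eq n by (metis ennreal_add_eq_top ennreal_neq_top)
    then show ?thesis
      unfolding ext_integral_def using n top by (simp add: enn2ereal_ennreal)
  qed
qed

lemma interaction_energy_eq_nn_energy:
  fixes W :: "real \<Rightarrow> real" and M :: real
  assumes \<mu>: "\<mu> \<in> borel_probs" and cont: "continuous_on UNIV W"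
    and M: "M \<ge> 0" and lb: "\<And>x. - M \<le> W x"
  shows "interaction_energy W \<mu> =
    ereal (1/2) * (enn2ereal (nn_energy (\<lambda>x. W x + M) \<mu>) - ereal M)"
proof -
  interpret prob_space \<mu> using \<mu> by (simp add: borel_probs_def)
  have sets[measurable_cong]: "sets \<mu> = sets borel" using \<mu> by (simp add: borel_probs_def)
  have W[measurable]: "W \<in> borel_measurable borel"
    using cont by (rule borel_measurable_continuous_onI)
  define F where "F y = (\<integral>\<^sup>+ x. ennreal (W (x - y) + M) \<partial>\<mu>)" for y
  have F[measurable]: "F \<in> borel_measurable \<mu>" unfolding F_def by measurable
  have inner: "ext_integral \<mu> (\<lambda>x. ereal (W (x - y))) = enn2ereal (F y) - ereal M" for y
    unfolding F_def
    by (subst ext_integral_shift[where c=M]) (use M lb in \<open>auto simp: prob_space_axioms\<close>)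
  have shift: "e2ennreal (enn2ereal (F y) - ereal M + ereal M) = F y" for y
  proof -
    have "enn2ereal (F y) - ereal M + ereal M = enn2ereal (F y)"
      by (cases "enn2ereal (F y)") auto
    then show ?thesis by simp
  qed
  have "ext_integral \<mu> (\<lambda>y. enn2ereal (F y) - ereal M) =
    enn2ereal (\<integral>\<^sup>+ y. e2ennreal (enn2ereal (F y) - ereal M + ereal M) \<partial>\<mu>) - ereal M"
  proof (rule ext_integral_shift)
    fix y show "- ereal M \<le> enn2ereal (F y) - ereal M"
      by (cases "enn2ereal (F y)") (use enn2ereal_nonneg[of "F y"] in auto)
  qed (use M in \<open>auto simp: prob_space_axioms\<close>)
  then have "ext_integral \<mu> (\<lambda>y. enn2ereal (F y) - ereal M) = enn2ereal (\<integral>\<^sup>+ y. F y \<partial>\<mu>) - ereal M"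
    unfolding shift .
  then show ?thesis
    unfolding interaction_energy_def inner by (simp add: nn_energy_def F_def)
qed

section \<open>Second variation at a minimizer\<close>

text \<open>
  The energy of \<open>(1 + e h) \<mu>\<close> is \<open>E + e L + e\<^sup>2 Q\<close>, where \<open>E\<close> is the energy of \<open>\<mu>\<close> and \<open>Q\<close> is the second
  variation. Minimality gives \<open>0 \<le> e L + e\<^sup>2 Q\<close> for both signs of a small \<open>e\<close>, and adding the two
  inequalities removes \<open>L\<close>.
\<close>
lemma second_variation_nonneg:
  fixes g h :: "real \<Rightarrow> real"
  assumes \<mu>: "\<mu> \<in> borel_probs"
    and g[measurable]: "g \<in> borel_measurable borel" and g0: "\<And>x. g x \<ge> 0"
    and fin: "nn_energy g \<mu> < \<infinity>"
    and min: "\<And>\<nu>. \<nu> \<in> borel_probs \<Longrightarrow> nn_energy g \<mu> \<le> nn_energy g \<nu>"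
    and h[measurable]: "h \<in> borel_measurable borel" and B: "\<And>x. \<bar>h x\<bar> \<le> B"
    and h0: "(\<integral>x. h x \<partial>\<mu>) = 0"
  shows "integrable (\<mu> \<Otimes>\<^sub>M \<mu>) (\<lambda>p. g (snd p - fst p))"
    and "0 \<le> (\<integral>p. g (snd p - fst p) * (h (fst p) * h (snd p)) \<partial>(\<mu> \<Otimes>\<^sub>M \<mu>))"
proof -
  interpret prob_space \<mu> using \<mu> by (simp add: borel_probs_def)
  interpret P: pair_prob_space \<mu> \<mu> ..
  have sets[measurable_cong]: "sets \<mu> = sets borel" using \<mu> by (simp add: borel_probs_def)
  have sp: "space \<mu> = UNIV" using sets_eq_imp_space_eq[OF sets] by simp
  let ?P = "\<mu> \<Otimes>\<^sub>M \<mu>"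
  let ?G = "\<lambda>p::real\<times>real. g (snd p - fst p)"
  have N\<mu>: "nn_energy g \<mu> = (\<integral>\<^sup>+ p. ennreal (?G p) \<partial>?P)"
    using nn_integral_fst[of "\<lambda>p. ennreal (?G p)" \<mu>] by (simp add: nn_energy_def)
  show G: "integrable ?P ?G"
    by (rule integrableI_nonneg) (use N\<mu> fin g0 in auto)
  have bdd: "integrable ?P (\<lambda>p. ?G p * k p)"
    if [measurable]: "k \<in> borel_measurable ?P" and "\<And>p. \<bar>k p\<bar> \<le> K" for k :: "real \<times> real \<Rightarrow> real" and K
  proof (rule Bochner_Integration.integrable_bound[OF integrable_mult_right[OF G, of K]])
    show "AE p in ?P. norm (?G p * k p) \<le> norm (K * ?G p)"
    proof (rule AE_I2)
      fix p
      have "\<bar>k p\<bar> \<le> \<bar>K\<bar>" using that(2)[of p] by linarith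
      then show "norm (?G p * k p) \<le> norm (K * ?G p)"
        by (simp add: abs_mult mult.commute mult_right_mono)
    qed
  qed measurable
  have B0: "B \<ge> 0" using B[of 0] by linarith
  have hh: "\<bar>h x * h y\<bar> \<le> B * B" for x y
    unfolding abs_mult using B B0 by (intro mult_mono) auto
  define L where "L = (\<integral>p. ?G p * (h (fst p) + h (snd p)) \<partial>?P)"
  define Q where "Q = (\<integral>p. ?G p * (h (fst p) * h (snd p)) \<partial>?P)"
  have iL: "integrable ?P (\<lambda>p. ?G p * (h (fst p) + h (snd p)))"
  proof (rule bdd)
    show "\<bar>h (fst p) + h (snd p)\<bar> \<le> B + B" for p
      using B[of "fst p"] B[of "snd p"] by linarith
  qed measurable
  have iQ: "integrable ?P (\<lambda>p. ?G p * (h (fst p) * h (snd p)))"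
    by (rule bdd[OF _ hh]) measurable
  have ih: "integrable \<mu> h"
    by (rule integrable_const_bound[where B=B]) (use B in auto)
  have step: "0 \<le> e * L + e\<^sup>2 * Q" if e: "\<bar>e\<bar> * B \<le> 1" for e
  proof -
    have pos: "0 \<le> 1 + e * h x" for x
    proof -
      have "\<bar>e * h x\<bar> \<le> \<bar>e\<bar> * B" unfolding abs_mult using B by (intro mult_left_mono) auto
      then show ?thesis using e by linarith
    qed
    have nonneg: "0 \<le> ?G p + e * (?G p * (h (fst p) + h (snd p)))
        + e\<^sup>2 * (?G p * (h (fst p) * h (snd p)))" for p
    proof -
      have "0 \<le> (1 + e * h (fst p)) * ((1 + e * h (snd p)) * ?G p)"
        using pos g0 by simp
      then show ?thesis by (simp add: algebra_simps power2_eq_square)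
    qed
    have expand: "(\<integral>p. ?G p + e * (?G p * (h (fst p) + h (snd p)))
        + e\<^sup>2 * (?G p * (h (fst p) * h (snd p))) \<partial>?P) = integral\<^sup>L ?P ?G + e * L + e\<^sup>2 * Q"
      unfolding L_def Q_def using G iL iQ by (simp add: Bochner_Integration.integral_add)
    define \<nu> where "\<nu> = density \<mu> (\<lambda>x. ennreal (1 + e * h x))"
    have "emeasure \<nu> (space \<nu>) = (\<integral>\<^sup>+ x. ennreal (1 + e * h x) \<partial>\<mu>)"
      unfolding \<nu>_def by (subst emeasure_density) (auto simp: sp)
    also have "\<dots> = ennreal (\<integral>x. 1 + e * h x \<partial>\<mu>)"
      by (rule nn_integral_eq_integral) (use ih pos in auto)
    also have "(\<integral>x. 1 + e * h x \<partial>\<mu>) = 1"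
      using ih h0 by (simp add: prob_space)
    finally have "prob_space \<nu>" by (intro prob_spaceI) simp
    then have "\<nu> \<in> borel_probs" by (simp add: borel_probs_def \<nu>_def sets)
    note min[OF this]
    also have "nn_energy g \<nu> =
      (\<integral>\<^sup>+ y. ennreal (1 + e * h y) * (\<integral>\<^sup>+ x. ennreal (1 + e * h x) * ennreal (g (x - y)) \<partial>\<mu>) \<partial>\<mu>)"
      unfolding nn_energy_def \<nu>_def by (simp add: nn_integral_density)
    also have "\<dots> = (\<integral>\<^sup>+ y. \<integral>\<^sup>+ x. ennreal (1 + e * h y) * (ennreal (1 + e * h x) * ennreal (g (x - y))) \<partial>\<mu> \<partial>\<mu>)"
      by (simp add: nn_integral_cmult)
    also have "\<dots> = (\<integral>\<^sup>+ p. ennreal (1 + e * h (fst p)) * (ennreal (1 + e * h (snd p)) * ennreal (?G p)) \<partial>?P)"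
      by (subst nn_integral_fst[symmetric]) auto
    also have "\<dots> = (\<integral>\<^sup>+ p. ennreal (?G p + e * (?G p * (h (fst p) + h (snd p)))
        + e\<^sup>2 * (?G p * (h (fst p) * h (snd p)))) \<partial>?P)"
    proof (rule nn_integral_cong)
      fix p
      have "(1 + e * h (fst p)) * ((1 + e * h (snd p)) * ?G p) =
        ?G p + e * (?G p * (h (fst p) + h (snd p))) + e\<^sup>2 * (?G p * (h (fst p) * h (snd p)))"
        by (simp add: algebra_simps power2_eq_square)
      then show "ennreal (1 + e * h (fst p)) * (ennreal (1 + e * h (snd p)) * ennreal (?G p)) =
        ennreal (?G p + e * (?G p * (h (fst p) + h (snd p))) + e\<^sup>2 * (?G p * (h (fst p) * h (snd p))))"
        using pos g0 by (simp flip: ennreal_mult)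
    qed
    also have "\<dots> = ennreal (\<integral>p. ?G p + e * (?G p * (h (fst p) + h (snd p)))
        + e\<^sup>2 * (?G p * (h (fst p) * h (snd p))) \<partial>?P)"
      by (rule nn_integral_eq_integral) (use G iL iQ nonneg in auto)
    also note expand
    also have "nn_energy g \<mu> = ennreal (integral\<^sup>L ?P ?G)"
      unfolding N\<mu> by (rule nn_integral_eq_integral) (use G g0 in auto)
    finally have le: "ennreal (integral\<^sup>L ?P ?G) \<le> ennreal (integral\<^sup>L ?P ?G + e * L + e\<^sup>2 * Q)" .
    moreover have "0 \<le> integral\<^sup>L ?P ?G + e * L + e\<^sup>2 * Q"
      unfolding expand[symmetric] by (rule Bochner_Integration.integral_nonneg) (rule nonneg)
    ultimately show ?thesis by (simp add: ennreal_le_iff)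
  qed
  \<comment> \<open>Small enough for \<open>1 + e h \<ge> 0\<close>; the summand \<open>1\<close> covers \<open>B = 0\<close>.\<close>
  define e where "e = 1 / (B + 1)"
  have e: "\<bar>e\<bar> * B \<le> 1" "\<bar>-e\<bar> * B \<le> 1" "e > 0" using B0 by (auto simp: e_def field_simps)
  from step[OF e(1)] step[OF e(2)] have "0 \<le> e\<^sup>2 * Q" by simp
  then show "0 \<le> (\<integral>p. ?G p * (h (fst p) * h (snd p)) \<partial>?P)"
    using e(3) unfolding Q_def by (simp add: zero_le_mult_iff)
qed

text \<open>
  Take \<open>h = \<Sum> (c\<^sub>i / m\<^sub>i) 1\<^bsub>B(i)\<^esub>\<close> with \<open>B(i)\<close> a small ball around \<open>i\<close> and \<open>m\<^sub>i\<close> its mass, which is positive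
  because \<open>i\<close> is in the support. The second variation is then \<open>\<Sum> c\<^sub>i c\<^sub>j A(i, j)\<close>, where \<open>A(i, j)\<close> is the mean of the
  kernel over \<open>B(i) \<times> B(j)\<close>; by continuity this is close to the kernel at the centres.
\<close>
lemma conditionally_positive_on_support:
  fixes g :: "real \<Rightarrow> real" and c :: "real \<Rightarrow> real"
  assumes \<mu>: "\<mu> \<in> borel_probs"
    and cont: "continuous_on UNIV g" and g0: "\<And>x. g x \<ge> 0"
    and fin: "nn_energy g \<mu> < \<infinity>"
    and min: "\<And>\<nu>. \<nu> \<in> borel_probs \<Longrightarrow> nn_energy g \<mu> \<le> nn_energy g \<nu>"
    and S: "finite S" "S \<subseteq> measure_support \<mu>" and c: "sum c S = 0"
  shows "0 \<le> (\<Sum>i\<in>S. \<Sum>j\<in>S. c i * c j * g (j - i))"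
proof -
  interpret prob_space \<mu> using \<mu> by (simp add: borel_probs_def)
  interpret P: pair_prob_space \<mu> \<mu> ..
  have sets[measurable_cong]: "sets \<mu> = sets borel" using \<mu> by (simp add: borel_probs_def)
  have g[measurable]: "g \<in> borel_measurable borel"
    using cont by (rule borel_measurable_continuous_onI)
  let ?P = "\<mu> \<Otimes>\<^sub>M \<mu>"
  let ?G = "\<lambda>p::real\<times>real. g (snd p - fst p)"
  define K where "K = (\<Sum>i\<in>S. \<Sum>j\<in>S. \<bar>c i * c j\<bar>)"
  have K0: "K \<ge> 0" unfolding K_def by (intro sum_nonneg) auto
  have approx: "- (\<eta> * K) \<le> (\<Sum>i\<in>S. \<Sum>j\<in>S. c i * c j * g (j - i))" if \<eta>: "\<eta> > 0" for \<eta>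
  proof -
    have "\<forall>\<^sub>F d in at_right 0. \<forall>q\<in>S \<times> S. \<forall>t. \<bar>t - (snd q - fst q)\<bar> < 2 * d \<longrightarrow> \<bar>g t - g (snd q - fst q)\<bar> \<le> \<eta>"
    proof (rule eventually_ball_finite)
      show "\<forall>q\<in>S \<times> S. \<forall>\<^sub>F d in at_right 0. \<forall>t. \<bar>t - (snd q - fst q)\<bar> < 2 * d \<longrightarrow> \<bar>g t - g (snd q - fst q)\<bar> \<le> \<eta>"
      proof
        fix q :: "real \<times> real"
        have "isCont g (snd q - fst q)" using cont by (simp add: continuous_on_eq_continuous_at)
        then obtain d where d: "d > 0" "\<And>t. \<bar>t - (snd q - fst q)\<bar> < d \<Longrightarrow> \<bar>g t - g (snd q - fst q)\<bar> < \<eta>"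
          using \<eta> unfolding continuous_at_eps_delta dist_real_def by blast
        show "\<forall>\<^sub>F d in at_right 0. \<forall>t. \<bar>t - (snd q - fst q)\<bar> < 2 * d \<longrightarrow> \<bar>g t - g (snd q - fst q)\<bar> \<le> \<eta>"
          unfolding eventually_at_right_field
          using d by (intro exI[of _ "d/2"]) (auto intro!: less_imp_le d(2))
      qed
    qed (use S in auto)
    \<comment> \<open>One radius \<open>d\<close> serves all pairs. If \<open>x\<close> and \<open>y\<close> are within \<open>d\<close> of \<open>i\<close> and \<open>j\<close>, then \<open>y - x\<close> is within \<open>2 d\<close> of \<open>j - i\<close>.\<close>
    then obtain d where d: "d > 0" and close: "\<And>i j t. i \<in> S \<Longrightarrow> j \<in> S \<Longrightarrow> \<bar>t - (j - i)\<bar> < 2 * d \<Longrightarrow> \<bar>g t - g (j - i)\<bar> \<le> \<eta>"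
      unfolding eventually_at_right_field
      by (metis (no_types, lifting) SigmaI dense fst_conv snd_conv)
    define m where "m i = measure \<mu> (ball i d)" for i
    have m: "m i > 0" if "i \<in> S" for i
    proof -
      have "emeasure \<mu> (ball i d) > 0"
        using that S d by (auto simp: measure_support_def subset_iff)
      then show ?thesis by (simp add: m_def emeasure_eq_measure)
    qed
    define I where "I i x = indicat_real (ball i d) x" for i x :: real
    have I[measurable]: "I i \<in> borel_measurable borel" for i
      unfolding I_def by (intro borel_measurable_indicator) simp
    have I01: "0 \<le> I i x" "I i x \<le> 1" for i x by (auto simp: I_def indicator_def)
    have intI: "integrable \<mu> (I i)" "(\<integral>x. I i x \<partial>\<mu>) = m i" for i
      unfolding I_def m_def by (auto simp: sets emeasure_eq_measure)
    define h where "h x = (\<Sum>i\<in>S. c i / m i * I i x)" for x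
    have h[measurable]: "h \<in> borel_measurable borel" unfolding h_def by measurable
    have hB: "\<bar>h x\<bar> \<le> (\<Sum>i\<in>S. \<bar>c i / m i\<bar>)" for x
      unfolding h_def
    proof (rule order_trans[OF sum_abs], rule sum_mono)
      fix i show "\<bar>c i / m i * I i x\<bar> \<le> \<bar>c i / m i\<bar>"
        using I01[of i x] unfolding abs_mult by (intro mult_left_le) auto
    qed
    have h0: "(\<integral>x. h x \<partial>\<mu>) = 0"
    proof -
      have "(\<integral>x. h x \<partial>\<mu>) = (\<Sum>i\<in>S. c i / m i * m i)"
        unfolding h_def by (simp add: intI)
      also have "\<dots> = sum c S" 
      proof (rule sum.cong)
        fix i assume "i \<in> S"
        then show "c i / m i * m i = c i" using m[of i] by simp
      qed simp
      finally show ?thesis using c by simp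
    qed
    note sv = second_variation_nonneg[OF \<mu> g g0 fin min h hB h0]
    have iG: "integrable ?P (\<lambda>p. ?G p * (I i (fst p) * I j (snd p)))" for i j
    proof (rule Bochner_Integration.integrable_bound[OF sv(1)])
      show "AE p in ?P. norm (?G p * (I i (fst p) * I j (snd p))) \<le> norm (?G p)"
        by (rule AE_I2) (auto simp: abs_mult I_def indicator_def)
    qed measurable
    have iI: "integrable ?P (\<lambda>p. I i (fst p) * I j (snd p))" for i j
      by (rule P.integrable_const_bound[where B=1]) (auto simp: I_def indicator_def)
    have vI: "(\<integral>p. I i (fst p) * I j (snd p) \<partial>?P) = m i * m j" for i j
      using P.integral_fst'[OF iI[of i j]] intI by simp
    define J where "J i j = (\<integral>p. ?G p * (I i (fst p) * I j (snd p)) \<partial>?P)" for i j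
    have J: "\<bar>J i j - g (j - i) * (m i * m j)\<bar> \<le> \<eta> * (m i * m j)" if "i \<in> S" "j \<in> S" for i j
    proof -
      have "J i j - g (j - i) * (m i * m j) =
        (\<integral>p. ?G p * (I i (fst p) * I j (snd p)) - g (j - i) * (I i (fst p) * I j (snd p)) \<partial>?P)"
        unfolding J_def vI[symmetric] using iG iI by simp
      also have "\<bar>\<dots>\<bar> \<le> (\<integral>p. \<eta> * (I i (fst p) * I j (snd p)) \<partial>?P)"
      proof (rule order_trans[OF integral_abs_bound], rule integral_mono)
        fix p
        have "\<bar>?G p - g (j - i)\<bar> \<le> \<eta>" if "fst p \<in> ball i d" "snd p \<in> ball j d"
          using that by (intro close \<open>i \<in> S\<close> \<open>j \<in> S\<close>) (auto simp: dist_real_def)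
        then show "\<bar>?G p * (I i (fst p) * I j (snd p)) - g (j - i) * (I i (fst p) * I j (snd p))\<bar>
            \<le> \<eta> * (I i (fst p) * I j (snd p))"
          by (auto simp: I_def indicator_def)
      qed (intro integrable_abs Bochner_Integration.integrable_diff integrable_mult_right iG iI)+
      also have "\<dots> = \<eta> * (m i * m j)" by (simp add: vI)
      finally show ?thesis .
    qed
    have "0 \<le> (\<integral>p. ?G p * (h (fst p) * h (snd p)) \<partial>?P)" by (rule sv(2))
    also have "(\<lambda>p. ?G p * (h (fst p) * h (snd p))) =
        (\<lambda>p. \<Sum>i\<in>S. \<Sum>j\<in>S. c i / m i * (c j / m j) * (?G p * (I i (fst p) * I j (snd p))))"
      unfolding h_def unfolding sum_product unfolding sum_distrib_left
      by (intro ext sum.cong refl) (simp add: algebra_simps)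
    also have "(\<integral>p. (\<Sum>i\<in>S. \<Sum>j\<in>S. c i / m i * (c j / m j) * (?G p * (I i (fst p) * I j (snd p)))) \<partial>?P)
        = (\<Sum>i\<in>S. \<Sum>j\<in>S. c i / m i * (c j / m j) * J i j)"
      unfolding J_def using iG by (simp add: Bochner_Integration.integral_sum)
    also have "\<dots> \<le> (\<Sum>i\<in>S. \<Sum>j\<in>S. c i * c j * g (j - i) + \<eta> * \<bar>c i * c j\<bar>)"
    proof (intro sum_mono)
      fix i j assume ij: "i \<in> S" "j \<in> S"
      define A where "A = J i j / (m i * m j)"
      have mi: "m i > 0" "m j > 0" using m ij by simp_all
      then have mm: "m i * m j > 0" by simp
      have JA: "J i j = A * (m i * m j)" using mi unfolding A_def by simp
      have "\<bar>A - g (j - i)\<bar> * (m i * m j) = \<bar>J i j - g (j - i) * (m i * m j)\<bar>"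
        unfolding JA left_diff_distrib[symmetric] abs_mult using mi by simp
      also have "\<dots> \<le> \<eta> * (m i * m j)" by (rule J[OF ij])
      finally have A: "\<bar>A - g (j - i)\<bar> \<le> \<eta>" using mm by (rule mult_right_le_imp_le)
      have "c i / m i * (c j / m j) * J i j = c i * c j * A"
        unfolding A_def by simp
      also have "\<dots> = c i * c j * g (j - i) + c i * c j * (A - g (j - i))"
        by (simp add: algebra_simps)
      also have "c i * c j * (A - g (j - i)) \<le> \<bar>c i * c j\<bar> * \<bar>A - g (j - i)\<bar>"
        by (metis abs_ge_self abs_mult)
      also have "\<dots> \<le> \<eta> * \<bar>c i * c j\<bar>" 
        using mult_left_mono[OF A abs_ge_zero[of "c i * c j"]] by (simp only: mult.commute[of \<eta>])
      finally show "c i / m i * (c j / m j) * J i j \<le> c i * c j * g (j - i) + \<eta> * \<bar>c i * c j\<bar>" by simp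
    qed
    also have "\<dots> = (\<Sum>i\<in>S. \<Sum>j\<in>S. c i * c j * g (j - i)) + \<eta> * K"
      unfolding K_def by (simp add: sum.distrib sum_distrib_left)
    finally show ?thesis by simp
  qed
  show ?thesis
  proof (rule ccontr)
    let ?Q = "\<Sum>i\<in>S. \<Sum>j\<in>S. c i * c j * g (j - i)"
    assume "\<not> 0 \<le> ?Q"
    then have neg: "?Q < 0" by simp
    \<comment> \<open>An \<open>\<eta>\<close> with \<open>\<eta> K < - ?Q\<close>; the summand \<open>1\<close> covers \<open>K = 0\<close>.\<close>
    have "- (- ?Q / (2 * (K + 1)) * K) \<le> ?Q"
      by (rule approx) (use neg K0 in \<open>auto simp: divide_neg_pos\<close>)
    moreover have "- ?Q / (2 * (K + 1)) * K < - ?Q"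
    proof -
      have "K / (2 * (K + 1)) < 1" using K0 by (simp add: field_simps)
      then have "- ?Q * (K / (2 * (K + 1))) < - ?Q * 1"
        using neg by (intro mult_strict_left_mono) auto
      then show ?thesis by simp
    qed
    ultimately show False by linarith
  qed
qed

text \<open>
  By the Lindelof property, countably many open null sets cover the complement of the support.
\<close>
lemma AE_in_measure_support:
  fixes \<mu> :: "'a::second_countable_topology measure"
  assumes "sets \<mu> = sets borel"
  shows "AE x in \<mu>. x \<in> measure_support \<mu>"
proof -
  define \<F> where "\<F> = {U. open U \<and> emeasure \<mu> U = 0}"
  obtain \<F>' where \<F>': "\<F>' \<subseteq> \<F>" "countable \<F>'" "\<Union>\<F>' = \<Union>\<F>"
    using Lindelof[of \<F>] by (auto simp: \<F>_def)
  have "\<Union>\<F>' \<in> null_sets \<mu>"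
    using \<F>' assms by (intro null_sets_UN'[of \<F>' "\<lambda>x. x", simplified]) (auto simp: \<F>_def null_sets_def)
  moreover have "- measure_support \<mu> = \<Union>\<F>"
    unfolding measure_support_def \<F>_def by auto
  ultimately show ?thesis
    using \<F>'(3) by (intro AE_I'[of "\<Union>\<F>'"]) (auto simp del: Union_iff)
qed

section \<open>Sets of reals without short triples\<close>

lemma card_le_2_if_no_chain:
  fixes T :: "'a::linorder set"
  assumes "finite T" and no: "\<And>x y z. x \<in> T \<Longrightarrow> y \<in> T \<Longrightarrow> z \<in> T \<Longrightarrow> x < y \<Longrightarrow> y < z \<Longrightarrow> False"
  shows "card T \<le> 2"
proof (cases "T = {}")
  case False
  have "T \<subseteq> {Min T, Max T}"
  proof
    fix y assume y: "y \<in> T"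
    show "y \<in> {Min T, Max T}"
      using no[of "Min T" y "Max T"] y assms(1) False
      by (metis Max_ge Max_in Min_in Min_le insertCI order_less_le)
  qed
  then have "card T \<le> card {Min T, Max T}" by (intro card_mono) auto
  also have "\<dots> \<le> 2" by (simp add: card_insert_if)
  finally show ?thesis .
qed simp

text \<open>
  Cut an interval of length \<open>D\<close> that starts at the minimum into half-open pieces of length \<open>r\<close>. Two points
  of one piece differ by less than \<open>r\<close>, so no piece contains three points.
\<close>
lemma card_le_of_sparse_triples:
  fixes T :: "real set" and r D :: real
  assumes fin: "finite T" and r: "r > 0"
    and diam: "\<And>x y. x \<in> T \<Longrightarrow> y \<in> T \<Longrightarrow> \<bar>x - y\<bar> < D"
    and no: "\<And>x y z. x \<in> T \<Longrightarrow> y \<in> T \<Longrightarrow> z \<in> T \<Longrightarrow> x < y \<Longrightarrow> y < z \<Longrightarrow> r \<le> z - x"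
    and ne: "T \<noteq> {}"
  shows "int (card T) \<le> 2 * \<lceil>D / r\<rceil>"
proof -
  define m where "m = Min T"
  have m: "m \<in> T" "\<And>x. x \<in> T \<Longrightarrow> m \<le> x" using fin ne by (auto simp: m_def)
  define k where "k = \<lceil>D / r\<rceil>"
  define b where "b x = \<lfloor>(x - m) / r\<rfloor>" for x
  have b: "b x \<in> {0..<k}" if "x \<in> T" for x
  proof -
    have "(x - m) / r < D / r" using diam[OF that m(1)] r by (intro divide_strict_right_mono) auto
    also have "\<dots> \<le> of_int k" unfolding k_def by simp
    finally have "b x < k" unfolding b_def by (simp add: floor_less_iff)
    moreover have "0 \<le> b x" unfolding b_def using m(2)[OF that] r by simp
    ultimately show ?thesis by simp
  qed
  have fibre: "card {x \<in> T. b x = i} \<le> 2" for i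
  proof (rule card_le_2_if_no_chain)
    fix x y z assume *: "x \<in> {x \<in> T. b x = i}" "y \<in> {x \<in> T. b x = i}" "z \<in> {x \<in> T. b x = i}" "x < y" "y < z"
    have "(z - m) / r < of_int i + 1" "of_int i \<le> (x - m) / r"
      using * by (auto simp: b_def floor_eq_iff)
    then have "(z - m) / r - (x - m) / r < 1" by linarith
    then have "z - x < r" using r by (simp add: field_simps)
    then show False using no[of x y z] * by auto
  qed (use fin in auto)
  have "k > 0" using b[OF m(1)] by simp
  have "T = (\<Union>i\<in>{0..<k}. {x \<in> T. b x = i})" using b by auto
  then have "card T = card (\<Union>i\<in>{0..<k}. {x \<in> T. b x = i})" by (rule arg_cong)
  also have "\<dots> \<le> (\<Sum>i\<in>{0..<k}. card {x \<in> T. b x = i})"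
    by (rule card_UN_le) simp
  also have "\<dots> \<le> (\<Sum>i\<in>{0..<k}. 2)" by (intro sum_mono fibre)
  also have "\<dots> = 2 * nat k" by simp
  finally show ?thesis using \<open>k > 0\<close> unfolding k_def[symmetric] by linarith
qed

section \<open>Superadditivity from convexity\<close>

text \<open>
  With \<open>f(0+) = 0\<close>, strict convexity puts \<open>f\<close> strictly below the chord from the origin to \<open>(s + t, f(s + t))\<close>; the values
  of this chord at \<open>s\<close> and \<open>t\<close> add up to \<open>f(s + t)\<close>.
\<close>
lemma superadditive_of_strictly_convex:
  fixes f :: "real \<Rightarrow> real"
  assumes conv: "strictly_convex_on {0<..<r} f" and lim: "(f \<longlongrightarrow> 0) (at_right 0)"
    and st: "s > 0" "t > 0" "s + t < r"
  shows "f s + f t < f (s + t)"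
proof -
  have sc: "f ((1 - l) * x + l * y) < (1 - l) * f x + l * f y"
    if "x \<in> {0<..<r}" "y \<in> {0<..<r}" "x \<noteq> y" "0 < l" "l < 1" for x y l
    using conv that unfolding strictly_convex_on_def by (simp)
  \<comment> \<open>The origin is outside the interval of convexity, so the chord is a limit of chords starting at \<open>e\<close>.\<close>
  have weak: "f x \<le> x / u * f u" if x: "0 < x" "x < u" "u < r" for x u
  proof (rule tendsto_lowerbound)
    show "((\<lambda>e. (u - x) / (u - e) * f e + (x - e) / (u - e) * f u) \<longlongrightarrow> x / u * f u) (at_right 0)"
      by (rule tendsto_eq_intros lim | use x in simp)+
    show "\<forall>\<^sub>F e in at_right 0. f x \<le> (u - x) / (u - e) * f e + (x - e) / (u - e) * f u"
      unfolding eventually_at_right_field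
    proof (intro exI[of _ x] conjI allI impI)
      fix e assume e: "0 < e" "e < x"
      let ?l = "(x - e) / (u - e)"
      have 1: "1 - ?l = (u - x) / (u - e)" using e x by (simp add: field_simps)
      have "(1 - ?l) * e + ?l * u = x"
        unfolding 1 using e x by (simp add: divide_simps) (simp add: algebra_simps)
      then show "f x \<le> (u - x) / (u - e) * f e + ?l * f u"
        using sc[of e u ?l] e x unfolding 1 by (simp add: divide_simps)
    qed (use x in auto)
  qed simp
  \<comment> \<open>The limit lost strictness. It is recovered from the chord between \<open>x/2\<close> and \<open>u\<close>.\<close>
  have strict: "f x < x / u * f u" if x: "0 < x" "x < u" "u < r" for x u
  proof -
    let ?l = "(x - x/2) / (u - x/2)"
    have l: "0 < ?l" "?l < 1" using x by (auto simp: field_simps)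
    have eq: "(1 - ?l) * (x/2) + ?l * u = x" using x by (simp add: divide_simps) (simp add: algebra_simps)
    have "f x < (1 - ?l) * f (x/2) + ?l * f u"
      using sc[of "x/2" u ?l] x l unfolding eq by simp
    also have "\<dots> \<le> (1 - ?l) * (x/2 / u * f u) + ?l * f u"
      using weak[of "x/2" u] x l by (intro add_right_mono mult_left_mono) auto
    also have "\<dots> = ((1 - ?l) * (x/2) + ?l * u) / u * f u"
      using x by (simp add: field_simps)
    also have "\<dots> = x / u * f u" unfolding eq ..
    finally show ?thesis .
  qed
  have "f s + f t < s / (s + t) * f (s + t) + t / (s + t) * f (s + t)"
    using st by (intro add_strict_mono strict) auto
  also have "\<dots> = (s / (s + t) + t / (s + t)) * f (s + t)" by (simp only: distrib_right)
  also have "s / (s + t) + t / (s + t) = 1" using st by (simp add: add_divide_distrib[symmetric])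
  finally show ?thesis by simp
qed

section \<open>Geometry of a set on which the kernel is conditionally positive\<close>

text \<open>
  The set \<open>S\<close> is later the support of a minimizer. The assumption \<open>pos\<close> says that the
  function \<open>-W(x - y)\<close> is conditionally negative definite on \<open>S\<close>, that is, a squared Hilbert space distance.
  Sums over two and three points already make its square root a pseudometric.
\<close>
locale conditionally_positive_kernel =
  fixes W :: "real \<Rightarrow> real" and S :: "real set" and R :: real
  assumes W0: "W 0 = 0" and even: "W (- x) = W x"
    and neg: "0 < \<bar>x\<bar> \<Longrightarrow> \<bar>x\<bar> < R \<Longrightarrow> W x < 0"
    and far: "\<bar>x\<bar> \<ge> R \<Longrightarrow> W x \<ge> 0"
    and pos: "finite F \<Longrightarrow> F \<subseteq> S \<Longrightarrow> sum c F = 0 \<Longrightarrow> 0 \<le> (\<Sum>i\<in>F. \<Sum>j\<in>F. c i * c j * W (j - i))"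
begin

lemma nonpos: 
  assumes "x \<in> S" "y \<in> S" shows "W (x - y) \<le> 0"
proof (cases "x = y")
  case False
  define c where "c z = (if z = x then 1 else - 1 :: real)" for z
  have "0 \<le> (\<Sum>i\<in>{x,y}. \<Sum>j\<in>{x,y}. c i * c j * W (j - i))"
    by (rule pos) (use False assms in \<open>auto simp: c_def\<close>)
  then show ?thesis using False W0 even[of "x - y"] by (simp add: c_def)
qed (simp add: W0)

text \<open>
  Weights \<open>p\<close>, \<open>-(p + q)\<close>, \<open>q\<close> at \<open>x\<close>, \<open>y\<close>, \<open>z\<close>. The choices of \<open>p\<close> and \<open>q\<close> in the next two lemmas give the
  two properties of the pseudometric that are needed.
\<close>
lemma three_point:
  assumes "x \<in> S" "y \<in> S" "z \<in> S" "x \<noteq> y" "y \<noteq> z" "x \<noteq> z"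
  shows "0 \<le> p * q * W (z - x) - p * (p + q) * W (y - x) - q * (p + q) * W (z - y)"
proof -
  define c where "c u = (if u = x then p else if u = z then q else - (p + q))" for u
  have c: "c x = p" "c z = q" "c y = - (p + q)" using assms by (auto simp: c_def)
  have sym: "W (x - y) = W (y - x)" "W (x - z) = W (z - x)" "W (y - z) = W (z - y)"
    using even[of "x - y"] even[of "x - z"] even[of "y - z"] by simp_all
  have "0 \<le> (\<Sum>i\<in>{x,y,z}. \<Sum>j\<in>{x,y,z}. c i * c j * W (j - i))"
    by (rule pos) (use assms c in auto)
  also have "\<dots> = 2 * (p * q * W (z - x) - p * (p + q) * W (y - x) - q * (p + q) * W (z - y))"
    using assms(4-6) by (simp add: c W0 sym) (simp add: algebra_simps)
  finally show ?thesis by simp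
qed

text \<open>
  Points at pseudodistance \<open>0\<close> are equivalent. With \<open>q = 1\<close> the three-point inequality is affine in \<open>p\<close>, with
  slope \<open>W(z - x) - W(z - y)\<close>, and it can hold for all real \<open>p\<close> only if the slope is \<open>0\<close>.
\<close>
lemma zero_imp_same:
  assumes S: "x \<in> S" "y \<in> S" "z \<in> S" and xy: "x \<noteq> y" and zero: "W (y - x) = 0"
  shows "W (z - x) = W (z - y)"
proof (cases "z = x \<or> z = y")
  case True
  then show ?thesis using zero even[of "x - y"] W0 by auto
next
  case False
  define A B where "A = W (z - x)" and "B = W (z - y)"
  have *: "0 \<le> p * (A - B) - B" for p
    using three_point[OF S, of p 1] False xy zero by (simp add: A_def B_def algebra_simps)
  show ?thesis
  proof (rule ccontr)
    assume "W (z - x) \<noteq> W (z - y)"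
    then have "A - B \<noteq> 0" by (simp add: A_def B_def)
    \<comment> \<open>At this \<open>p\<close> the affine function \<open>p (A - B) - B\<close> takes the value \<open>-1\<close>.\<close>
    then show False using *[of "(B - 1) / (A - B)"] by simp
  qed
qed

lemma triangle:
  assumes S: "x \<in> S" "y \<in> S" "z \<in> S" and xyz: "x < y" "y < z" and near: "z - x < R"
  shows "sqrt (- W (z - x)) \<le> sqrt (- W (y - x)) + sqrt (- W (z - y))"
proof -
  define a b d where "a = sqrt (- W (y - x))" and "b = sqrt (- W (z - y))" and "d = sqrt (- W (z - x))"
  have W: "W (y - x) < 0" "W (z - y) < 0" "W (z - x) < 0"
    using xyz near by (auto intro!: neg)
  have pos: "a > 0" "b > 0" "d > 0" using W by (auto simp: a_def b_def d_def)
  have sq: "W (y - x) = - a\<^sup>2" "W (z - y) = - b\<^sup>2" "W (z - x) = - d\<^sup>2"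
    using W by (simp_all add: a_def b_def d_def)
  \<comment> \<open>The weights \<open>b\<close> and \<open>a\<close> at the outer points make the inequality factor.\<close>
  have "0 \<le> b * a * W (z - x) - b * (b + a) * W (y - x) - a * (b + a) * W (z - y)"
    by (rule three_point) (use S xyz in auto)
  also have "\<dots> = (a * b) * ((a + b)\<^sup>2 - d\<^sup>2)"
    unfolding sq by (simp add: algebra_simps power2_eq_square)
  finally have "0 \<le> (a * b) * ((a + b)\<^sup>2 - d\<^sup>2)" .
  moreover have "a * b > 0" using pos by simp
  ultimately have "0 \<le> (a + b)\<^sup>2 - d\<^sup>2" by (metis mult_pos_neg not_le)
  then have "d\<^sup>2 \<le> (a + b)\<^sup>2" by simp
  then have "d \<le> a + b" by (rule power2_le_imp_le) (use pos in simp)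
  then show ?thesis unfolding a_def b_def d_def .
qed

text \<open>
  If \<open>b - a \<ge> R\<close>, then \<open>a\<close> and \<open>b\<close> are equivalent. A third point \<open>z\<close> that is equivalent to them would be at
  distance at least \<open>R\<close> from both. But some point \<open>p\<close> is not equivalent to \<open>a\<close>, because \<open>W(P - Q) < 0\<close>, and it
  would be closer than \<open>R\<close> to each of \<open>a\<close>, \<open>b\<close>, \<open>z\<close>. That is impossible: \<open>p\<close> lies strictly between
  any two of them, and three points on a line do not have a common point between each two. So each remaining
  point is closer than \<open>R\<close> to both \<open>a\<close> and \<open>b\<close>.
\<close>
lemma diam_after_removal:
  assumes PQ: "P \<in> S" "Q \<in> S" "W (P - Q) < 0"
  obtains b where "\<And>x y. x \<in> S - {b} \<Longrightarrow> y \<in> S - {b} \<Longrightarrow> \<bar>x - y\<bar> < R"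
proof (cases "\<forall>x\<in>S. \<forall>y\<in>S. \<bar>x - y\<bar> < R")
  case True
  show ?thesis by (rule that[of 0]) (use True in auto)
next
  case False
  have "\<not> \<bar>P - Q\<bar> \<ge> R" using far[of "P - Q"] PQ(3) by force
  then have R: "R > 0" by linarith
  obtain a b where ab: "a \<in> S" "b \<in> S" "b - a \<ge> R"
  proof -
    obtain x y where "x \<in> S" "y \<in> S" "\<bar>x - y\<bar> \<ge> R" using False by force
    then have "x \<in> S \<and> y \<in> S \<and> y - x \<ge> R \<or> y \<in> S \<and> x \<in> S \<and> x - y \<ge> R" by linarith
    then show ?thesis using that[of x y] that[of y x] by argo
  qed
  have zero: "W (y - x) = 0" if "x \<in> S" "y \<in> S" "\<bar>y - x\<bar> \<ge> R" for x y
    using nonpos[OF that(2,1)] far[OF that(3)] by simp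
  have near: "\<bar>y - x\<bar> < R" if "W (y - x) < 0" for x y
    using far[of "y - x"] that by linarith
  have Wab: "W (b - a) = 0" by (rule zero) (use ab R in auto)
  have "a \<noteq> b" using ab R by auto
  have key: "\<bar>z - a\<bar> < R \<and> \<bar>z - b\<bar> < R" if z: "z \<in> S" "z \<noteq> a" "z \<noteq> b" for z
  proof -
    have same: "W (u - a) = W (u - b)" if "u \<in> S" for u
      using zero_imp_same[OF ab(1,2) that \<open>a \<noteq> b\<close> Wab] .
    have "W (z - a) < 0"
    proof (rule ccontr)
      assume "\<not> W (z - a) < 0"
      then have za: "W (z - a) = 0" using nonpos[OF z(1) ab(1)] by simp
      then have zb: "W (z - b) = 0" using same[OF z(1)] by simp
      have samez: "W (u - a) = W (u - z)" if "u \<in> S" for u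
        using zero_imp_same[OF ab(1) z(1) that] z za by auto
      obtain p where p: "p \<in> S" "W (p - a) < 0"
      proof (cases "W (P - a) < 0")
        case False
        then have Pa: "W (P - a) = 0" using nonpos[OF PQ(1) ab(1)] by simp
        have "W (Q - a) < 0"
        proof (cases "P = a")
          case True then show ?thesis using PQ(3) even[of "P - Q"] by simp
        next
          case False
          then show ?thesis
            using zero_imp_same[OF ab(1) PQ(1,2) _ Pa] PQ(3) even[of "P - Q"] by auto
        qed
        then show ?thesis by (rule that[OF PQ(2)])
      qed (rule that[OF PQ(1)])
      have "\<bar>p - a\<bar> < R" "\<bar>p - b\<bar> < R" "\<bar>p - z\<bar> < R"
        using p same[OF p(1)] samez[OF p(1)] by (auto intro!: near)
      moreover have "\<bar>z - a\<bar> \<ge> R" "\<bar>z - b\<bar> \<ge> R"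
        using neg[of "z - a"] neg[of "z - b"] za zb z by force+
      \<comment> \<open>No position of \<open>z\<close> relative to \<open>a\<close> and \<open>b\<close> is compatible with these distances.\<close>
      ultimately show False using ab(3) by linarith
    qed
    then show ?thesis using same[OF z(1)] by (auto intro!: near)
  qed
  \<comment> \<open>Two points of \<open>(b - R, a + R)\<close> differ by less than \<open>2 R - (b - a) \<le> R\<close>.\<close>
  show ?thesis
  proof (rule that[of b])
    fix x y assume "x \<in> S - {b}" "y \<in> S - {b}"
    then have "x = a \<or> \<bar>x - a\<bar> < R \<and> \<bar>x - b\<bar> < R" "y = a \<or> \<bar>y - a\<bar> < R \<and> \<bar>y - b\<bar> < R"
      using key by blast+
    then show "\<bar>x - y\<bar> < R"
      using ab(3) R by linarith
  qed
qed

end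

section \<open>The cardinality of the support\<close>

lemma bounded_below_if_nonneg_far:
  fixes W :: "real \<Rightarrow> real"
  assumes "continuous_on UNIV W" and far: "\<And>x. \<bar>x\<bar> \<ge> R \<Longrightarrow> W x \<ge> 0"
  obtains M where "M \<ge> 0" "\<And>x. - M \<le> W x"
proof -
  have "bounded (W ` {-R..R})"
    using assms(1) by (intro compact_imp_bounded compact_continuous_image continuous_on_subset[OF assms(1)]) auto
  then obtain M where "\<forall>y\<in>W ` {-R..R}. norm y \<le> M" unfolding bounded_iff by blast
  then have M: "\<bar>W x\<bar> \<le> M" if "x \<in> {-R..R}" for x using that by auto
  show ?thesis
  proof (rule that[of "\<bar>M\<bar>"])
    fix x show "- \<bar>M\<bar> \<le> W x"
      using M[of x] far[of x] by (cases "\<bar>x\<bar> \<ge> R") force+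
  qed auto
qed

text \<open>
  The competitor is \<open>\<nu> = (\<delta>\<^sub>a + \<delta>\<^sub>b)/2\<close>.
\<close>
lemma nn_energy_two_points:
  fixes g :: "real \<Rightarrow> real"
  assumes "a \<noteq> b" and g0: "\<And>x. g x \<ge> 0" and [measurable]: "g \<in> borel_measurable borel"
    and "g (a - b) = g (b - a)"
  obtains \<nu> where "\<nu> \<in> borel_probs" "nn_energy g \<nu> = ennreal ((g 0 + g (a - b)) / 2)"
proof -
  define \<nu> where "\<nu> = distr (measure_pmf (pmf_of_set {a, b})) borel (\<lambda>x. x)"
  have int: "(\<integral>\<^sup>+ x. ennreal (f x) \<partial>\<nu>) = ennreal ((f a + f b) / 2)"
    if [measurable]: "f \<in> borel_measurable borel" and "\<And>x. f x \<ge> 0" for f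
  proof -
    have "(\<integral>\<^sup>+ x. ennreal (f x) \<partial>\<nu>) = (\<integral>\<^sup>+ x. ennreal (f x) \<partial>measure_pmf (pmf_of_set {a, b}))"
      unfolding \<nu>_def by (subst nn_integral_distr) auto
    also have "\<dots> = ennreal ((f a + f b) / 2)"
      using assms(1) that(2) by (subst nn_integral_pmf_of_set) (simp_all add: ennreal_plus[symmetric] ennreal_divide_numeral del: ennreal_plus)
    finally show ?thesis .
  qed
  have "prob_space \<nu>" unfolding \<nu>_def by (intro measure_pmf.prob_space_distr) simp
  then have "\<nu> \<in> borel_probs" by (simp add: borel_probs_def \<nu>_def)
  moreover have "nn_energy g \<nu> = ennreal ((g 0 + g (a - b)) / 2)"
    unfolding nn_energy_def using g0 assms(4) by (simp add: int add_ac)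
  ultimately show ?thesis using that by blast
qed

theorem theorem4p5:
  fixes W w :: "real \<Rightarrow> real" and R r \<alpha> C :: real and \<mu> :: "real measure"
  assumes "class_C2 W"
    and "\<And>x. W x = w \<bar>x\<bar>"
    and "W 0 = 0"
    and "R > 0"
    and "\<And>x. 0 < \<bar>x\<bar> \<Longrightarrow> \<bar>x\<bar> < R \<Longrightarrow> W x < 0"
    and "\<And>x. \<bar>x\<bar> \<ge> R \<Longrightarrow> W x \<ge> 0"
    and "\<alpha> > 2"
    and "C > 0"
    and "((\<lambda>s. deriv w s * s powr (1 - \<alpha>)) \<longlongrightarrow> - C) (at_right 0)"
    and "r \<in> {0<..R}"
    and "strictly_convex_on {0<..<r} (\<lambda>s. sqrt (- w s))"
    and "global_minimizer W \<mu>"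
  shows "finite (measure_support \<mu>) \<and> int (card (measure_support \<mu>)) \<le> 2 * \<lceil>R / r\<rceil> + 1"
proof -
  let ?S = "measure_support \<mu>"
  have even: "W (- x) = W x" for x by (simp add: assms(2))
  have cont: "continuous_on UNIV W"
    using assms(1) unfolding class_C2_def by (metis DERIV_isCont continuous_on_eq_continuous_at open_UNIV)
  obtain M where M: "M \<ge> 0" "\<And>x. - M \<le> W x"
    using bounded_below_if_nonneg_far[OF cont assms(6)] by blast
  define g where "g x = W x + M" for x
  have g0: "g x \<ge> 0" for x using M(2)[of x] by (simp add: g_def)
  have gcont: "continuous_on UNIV g" unfolding g_def using cont by (intro continuous_intros)
  then have gm: "g \<in> borel_measurable borel" by (rule borel_measurable_continuous_onI)
  have \<mu>: "\<mu> \<in> borel_probs" using assms(12) by (simp add: global_minimizer_def)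
  have min: "nn_energy g \<mu> \<le> nn_energy g \<nu>" if \<nu>: "\<nu> \<in> borel_probs" for \<nu>
  proof -
    have "interaction_energy W \<mu> \<le> interaction_energy W \<nu>"
      using assms(12) \<nu> by (simp add: global_minimizer_def)
    then have "ereal (1/2) * (enn2ereal (nn_energy g \<mu>) - ereal M)
        \<le> ereal (1/2) * (enn2ereal (nn_energy g \<nu>) - ereal M)"
      unfolding interaction_energy_eq_nn_energy[OF \<mu> cont M] interaction_energy_eq_nn_energy[OF \<nu> cont M]
      by (simp add: g_def[abs_def])
    then have "enn2ereal (nn_energy g \<mu>) \<le> enn2ereal (nn_energy g \<nu>)"
      using enn2ereal_nonneg[of "nn_energy g \<mu>"] enn2ereal_nonneg[of "nn_energy g \<nu>"]
      by (cases "enn2ereal (nn_energy g \<mu>)"; cases "enn2ereal (nn_energy g \<nu>)") auto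
    then show ?thesis by (simp add: less_eq_ennreal.rep_eq)
  qed
  \<comment> \<open>Two equal masses at distance \<open>R/2\<close> have negative energy, which is an \<open>nn_energy\<close> below the shift \<open>M\<close>.\<close>
  obtain \<nu> where \<nu>: "\<nu> \<in> borel_probs" "nn_energy g \<nu> = ennreal ((g 0 + g (0 - R/2)) / 2)"
    by (rule nn_energy_two_points[of 0 "R/2" g]) (use assms(4) g0 gm even[of "R/2"] in \<open>auto simp: g_def\<close>)
  have "(g 0 + g (0 - R/2)) / 2 < M"
    using assms(5)[of "0 - R/2"] assms(3,4) by (simp add: g_def)
  moreover have "(g 0 + g (0 - R/2)) / 2 \<ge> 0" using g0 by simp
  ultimately have less: "nn_energy g \<mu> < ennreal M"
    using min[OF \<nu>(1)] \<nu>(2) by (auto intro: le_less_trans simp: ennreal_less_iff)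
  then have fin: "nn_energy g \<mu> < \<infinity>" using less_le_trans by fastforce
  interpret conditionally_positive_kernel W ?S R
  proof
    fix F and c :: "real \<Rightarrow> real" assume F: "finite F" "F \<subseteq> ?S" "sum c F = 0"
    have "0 \<le> (\<Sum>i\<in>F. \<Sum>j\<in>F. c i * c j * g (j - i))"
      by (rule conditionally_positive_on_support[OF \<mu> gcont g0 fin min F])
    \<comment> \<open>The shift by \<open>M\<close> contributes nothing to sums with total weight \<open>0\<close>.\<close>
    also have "\<dots> = (\<Sum>i\<in>F. \<Sum>j\<in>F. c i * c j * W (j - i)) + M * (sum c F * sum c F)"
      unfolding g_def sum_product by (simp add: algebra_simps sum.distrib sum_distrib_left)
    finally show "0 \<le> (\<Sum>i\<in>F. \<Sum>j\<in>F. c i * c j * W (j - i))" using F by simp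
  qed (use assms even in auto)
  \<comment> \<open>The set of pairs of support points has full product measure, so \<open>W \<ge> 0\<close> on it would make the energy nonnegative.\<close>
  obtain P Q where PQ: "P \<in> ?S" "Q \<in> ?S" "W (P - Q) < 0"
  proof (rule ccontr)
    assume "\<not> thesis"
    then have nonneg: "W (x - y) \<ge> 0" if "x \<in> ?S" "y \<in> ?S" for x y
      using that \<open>\<And>Q P. \<lbrakk>P \<in> ?S; Q \<in> ?S; W (P - Q) < 0\<rbrakk> \<Longrightarrow> thesis\<close> by (meson not_less)
    interpret prob_space \<mu> using \<mu> by (simp add: borel_probs_def)
    have AE: "AE x in \<mu>. x \<in> ?S"
      by (rule AE_in_measure_support) (use \<mu> in \<open>simp add: borel_probs_def\<close>)
    have "ennreal M = (\<integral>\<^sup>+ y. \<integral>\<^sup>+ x. ennreal M \<partial>\<mu> \<partial>\<mu>)" by (simp add: emeasure_space_1)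
    also have "\<dots> \<le> nn_energy g \<mu>"
      unfolding nn_energy_def
    proof (rule nn_integral_mono_AE)
      show "AE y in \<mu>. (\<integral>\<^sup>+ x. ennreal M \<partial>\<mu>) \<le> (\<integral>\<^sup>+ x. ennreal (g (x - y)) \<partial>\<mu>)"
        using AE
      proof eventually_elim
        case (elim y)
        show ?case
        proof (rule nn_integral_mono_AE)
          show "AE x in \<mu>. ennreal M \<le> ennreal (g (x - y))"
            using AE by eventually_elim (use nonneg elim in \<open>auto simp: g_def intro!: ennreal_leI\<close>)
        qed
      qed
    qed
    finally show False using less by simp
  qed
  have r: "0 < r" "r \<le> R" using assms(10) by auto
  have triples: "r \<le> z - x" if S: "x \<in> ?S" "y \<in> ?S" "z \<in> ?S" and lt: "x < y" "y < z" for x y z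
  proof (rule ccontr)
    assume "\<not> r \<le> z - x"
    then have zx: "z - x < r" by simp
    have lim: "((\<lambda>s. sqrt (- w s)) \<longlongrightarrow> 0) (at_right 0)"
    proof -
      have "(W \<longlongrightarrow> W 0) (at_right 0)"
        using cont by (metis UNIV_I continuous_on_def tendsto_within_subset top_greatest)
      then have "((\<lambda>s. sqrt (- W s)) \<longlongrightarrow> sqrt (- W 0)) (at_right 0)" by (intro tendsto_intros)
      moreover have "\<forall>\<^sub>F s in at_right 0. sqrt (- W s) = sqrt (- w s)"
        using assms(2) by (auto simp: eventually_at_right_field intro!: exI[of _ 1])
      ultimately have "((\<lambda>s. sqrt (- w s)) \<longlongrightarrow> sqrt (- W 0)) (at_right 0)"
        by (rule Lim_transform_eventually)
      then show ?thesis by (simp add: assms(3))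
    qed
    have "sqrt (- w (y - x)) + sqrt (- w (z - y)) < sqrt (- w (y - x + (z - y)))"
      by (rule superadditive_of_strictly_convex[OF assms(11) lim]) (use lt zx in auto)
    moreover have "sqrt (- W (z - x)) \<le> sqrt (- W (y - x)) + sqrt (- W (z - y))"
      by (rule triangle[OF S lt]) (use zx r in auto)
    ultimately show False using lt by (simp add: assms(2))
  qed
  obtain b where b: "\<And>x y. x \<in> ?S - {b} \<Longrightarrow> y \<in> ?S - {b} \<Longrightarrow> \<bar>x - y\<bar> < R"
    using diam_after_removal[OF PQ] by blast
  have k: "\<lceil>R / r\<rceil> > 0" using r by simp
  have bound: "int (card F) \<le> 2 * \<lceil>R / r\<rceil> + 1" if F: "F \<subseteq> ?S" "finite F" for F
  proof (cases "F - {b} = {}")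
    case True
    then have "card F \<le> 1" using card_mono[of "{b}" F] by auto
    then show ?thesis using k by linarith
  next
    case False
    have "int (card (F - {b})) \<le> 2 * \<lceil>R / r\<rceil>"
      by (rule card_le_of_sparse_triples[OF _ r(1) _ _ False]) (use F b triples in blast)+
    moreover have "card F \<le> card (F - {b}) + 1"
      unfolding card_Diff_singleton_if by (split if_split) arith
    ultimately show ?thesis by linarith
  qed
  have "finite ?S \<and> card ?S \<le> nat (2 * \<lceil>R / r\<rceil> + 1)"
  proof (rule finite_if_finite_subsets_card_bdd)
    fix F assume "F \<subseteq> ?S" "finite F"
    then show "card F \<le> nat (2 * \<lceil>R / r\<rceil> + 1)" using bound[of F] by linarith
  qed
  then show ?thesis using k by linarith
qed

end
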